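(* Let $m\ge 1$ and $N\ge m$ be integers. Let $X_N\subseteq\{0,1\}^N$ be the set of words $w=w_0\cdots w_{N-1}$ with $w_i+w_{i+1}+\cdots+w_{i+m}\le 1$ for $i=0,1,\dots,N-m-1$. For $i\in\{0,\dots,N-1\}$ let the toggle $\tau_i:X_N\to X_N$ map $w$ to the word obtained by replacing $w_i$ with $1-w_i$ if the result lies in $X_N$, and to $w$ itself otherwise, and let $\varphi=\tau_{N-1}\circ\tau_{N-2}\circ\cdots\circ\tau_0$. Then for every $S\in X_N$ and every $i\in\{0,1,\dots,N-1\}$, \[ \sum_{t=0}^{q-1}\varphi^t(S)_i=\sum_{t=0}^{q-1}\varphi^t(S)_{N-1-i}, \] where $q$ is the smallest positive integer with $\varphi^q(S)=S$ and $\varphi^t(S)_i$ denotes the $i$-th letter of $\varphi^t(S)$.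
   Context: Each $\tau_i$ is a bijection of $X_N$, so $\varphi$ is a bijection of the finite set $X_N$ and every $S$ has a finite $\varphi$-orbit. For $m=1$, $X_N$ is the set of independent sets of the path graph on $N$ vertices (as indicator words). *)

theory Defs
  imports Main
begin

(* A word w_0 ... w_{N-1} is a list of letters 0 and 1.  The window condition
   for i = 0, ..., N - m - 1 is written with "i + m < N", which avoids truncated
   subtraction; it is vacuous for N = m. *)
definition words :: "nat \<Rightarrow> nat \<Rightarrow> nat list set" where
  "words m N = {w. length w = N \<and> set w \<subseteq> {0, 1} \<and>
                   (\<forall>i. i + m < N \<longrightarrow> (\<Sum>j = i..i + m. w ! j) \<le> 1)}"

definition toggle :: "nat \<Rightarrow> nat \<Rightarrow> nat \<Rightarrow> nat list \<Rightarrow> nat list" where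
  "toggle m N i w =
     (let w' = w[i := 1 - w ! i] in if w' \<in> words m N then w' else w)"

(* "fold" applies the toggle at position 0 first and the one at N - 1 last. *)
definition sweep :: "nat \<Rightarrow> nat \<Rightarrow> nat list \<Rightarrow> nat list" where
  "sweep m N = fold (toggle m N) [0..<N]"

definition period :: "('a \<Rightarrow> 'a) \<Rightarrow> 'a \<Rightarrow> nat" where
  "period f x = (LEAST q. 0 < q \<and> (f ^^ q) x = x)"

end

theory Submission imports Defs begin

text \<open>Assume \<open>m < N\<close> (for \<open>N = m\<close> there is no constraint and a sweep complements every letter), and
  write the words of the orbit below each other. If \<open>(t, x)\<close> is a 1 of this board with
  \<open>x < N - 1\<close>, then exactly one of \<open>(t, x + m + 1)\<close> and \<open>(t + 1, x + 1)\<close> is a 1, and dually to the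
  left. So the 1s split into snakes from column \<open>0\<close> to column \<open>N - 1\<close>, and the column sums count
  the prefix sums of the snake words in \<open>a = 1\<close>, \<open>b = m + 1\<close>.

  Parse a snake word greedily into blocks \<open>a\<^sup>m\<close> and \<open>a\<^sup>x b\<close> (\<open>x < m\<close>) and a remainder \<open>a\<^sup>l\<close>
  (\<open>l < m\<close>). The next snake arises by deleting the first block and appending its reversal; hence the
  sequence of block types is rotated, and the sequence of the exponents \<open>x\<close>, followed by \<open>l\<close>, is
  rotated exactly when a block \<open>a\<^sup>x b\<close> is moved. As there is one exponent more than there are
  blocks \<open>a\<^sup>x b\<close>, an orbit average is an average over all pairs of independent rotations of the two
  sequences. After averaging over the exponents, the number of prefixes of given sum depends only on
  how many cyclic windows of block types have given content and are followed by a given type. A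
  telescoping argument shows that as many windows are preceded by that type, so the average is
  invariant under reversal of the words.\<close>

subsection \<open>Words and their block structure\<close>

text \<open>Snake words: \<open>False\<close> is a step to the next row and next column, \<open>True\<close> a step
  of \<open>m + 1\<close> columns inside a row. \<open>visits m u z\<close> is 1 if a snake with word \<open>u\<close> meets the
  column at distance \<open>z\<close> from its start, and 0 otherwise.\<close>

fun visits :: "nat \<Rightarrow> bool list \<Rightarrow> int \<Rightarrow> int" where
  "visits m [] z = of_bool (z = 0)"
| "visits m (c # u) z = of_bool (z = 0) + visits m u (z - (if c then int m + 1 else 1))"

definition span :: "nat \<Rightarrow> bool list \<Rightarrow> int" where
  "span m u = (\<Sum>c\<leftarrow>u. if c then int m + 1 else 1)"

lemma span_simps [simp]:
  "span m [] = 0"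
  "span m (c # u) = (if c then int m + 1 else 1) + span m u"
  "span m (u @ u') = span m u + span m u'"
  "span m (replicate n False) = int n"
  by (auto simp: span_def sum_list_replicate)

lemma visits_neg: "z < 0 \<Longrightarrow> visits m u z = 0"
  by (induction u arbitrary: z) auto

lemma visits_0: "visits m u 0 = 1"
  by (cases u) (auto simp: visits_neg)

lemma visits_snoc:
  "visits m (u @ [c]) z = visits m u z + of_bool (z = span m u + (if c then int m + 1 else 1))"
  by (induction u arbitrary: z) auto

text \<open>A prefix of \<open>rev u\<close> is the reversal of a suffix of \<open>u\<close>, so its
  sum is \<open>span m u\<close> minus a prefix sum of \<open>u\<close>.\<close>

lemma visits_rev: "visits m (rev u) z = visits m u (span m u - z)"
proof (induction u arbitrary: z)
  case (Cons c u)
  have "span m (rev u) = span m u" by (simp add: span_def rev_map[symmetric])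
  then show ?case by (auto simp: visits_snoc Cons.IH algebra_simps)
qed auto

section \<open>Encoding words by block types and exponents\<close>

text \<open>With \<open>a = False\<close> and \<open>b = True\<close>: a block type \<open>True\<close> stands for the block
  \<open>a\<^sup>m\<close>, a block type \<open>False\<close> for \<open>a\<^sup>x b\<close> with \<open>x\<close> the next entry of \<open>v\<close>; the last entry
  of \<open>v\<close> is the exponent of the remaining \<open>a\<close>s.\<close>

fun encode :: "nat \<Rightarrow> bool list \<Rightarrow> nat list \<Rightarrow> bool list" where
  "encode m [] v = replicate (hd v) False"
| "encode m (s # ss) v =
    (if s then replicate m False @ encode m ss v
     else replicate (hd v) False @ True # encode m ss (tl v))"

lemma encode_snoc_True:
  "encode m (ss @ [True]) v = encode m ss v @ replicate m False"
  by (induction ss arbitrary: v) (auto simp flip: replicate_add simp: add.commute)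

text \<open>By the length condition the last entry of \<open>v\<close> is the remainder of the old
  word. It becomes the exponent of the new block, and \<open>x\<close> becomes the new
  remainder.\<close>

lemma encode_snoc_False:
  assumes "length v = Suc (count_list ss False)"
  shows "encode m (ss @ [False]) (v @ [x]) = encode m ss v @ True # replicate x False"
  using assms
proof (induction ss arbitrary: v)
  case Nil
  then show ?case by (auto simp: length_Suc_conv)
next
  case (Cons s ss)
  from Cons.prems obtain y w where "v = y # w" by (cases v) auto
  with Cons.prems Cons.IH[of v] Cons.IH[of w] show ?case by simp
qed

text \<open>The letters \<open>True\<close> cut the word into gaps, each made of some full blocks
  \<open>a^m\<close> and one power \<open>a^x\<close>. These commute inside a gap, so reversal only
  reverses the order of the gaps.\<close>

lemma rev_encode:
  assumes "length v = Suc (count_list ss False)"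
  shows "rev (encode m ss v) = encode m (rev ss) (rev v)"
  using assms
proof (induction ss arbitrary: v)
  case Nil
  then show ?case by (auto simp: length_Suc_conv)
next
  case (Cons s ss)
  show ?case
  proof (cases s)
    case True
    with Cons show ?thesis by (simp add: encode_snoc_True)
  next
    case False
    with Cons.prems obtain x v' where v: "v = x # v'" and l: "length v' = Suc (count_list ss False)"
      by (cases v) auto
    show ?thesis using Cons.IH[OF l] False v l by (simp add: encode_snoc_False)
  qed
qed

section \<open>Existence and uniqueness of the greedy parse\<close>

text \<open>Split off \<open>a^m\<close> whenever possible. Otherwise the leading run of
  \<open>a\<close> has length \<open>x < m\<close> and is either the whole word or followed by
  \<open>True\<close>.\<close>

lemma encode_exhaust:
  assumes "m \<ge> 1"
  shows "\<exists>ss v. length v = Suc (count_list ss False) \<and> (\<forall>x\<in>set v. x < m) \<and> u = encode m ss v"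
proof (induction u rule: length_induct)
  case (1 u)
  show ?case
  proof (cases "\<exists>u'. u = replicate m False @ u'")
    case True
    then obtain u' where u: "u = replicate m False @ u'" by blast
    with assms have "length u' < length u" by simp
    with 1 obtain ss v where "length v = Suc (count_list ss False)" "\<forall>x\<in>set v. x < m" "u' = encode m ss v"
      by blast
    with u show ?thesis by (intro exI[of _ "True # ss"] exI[of _ v]) simp
  next
    case False
    define x where "x = length (takeWhile Not u)"
    have tw: "takeWhile Not u = replicate x False"
      unfolding x_def by (rule replicate_length_same[symmetric]) (auto dest: set_takeWhileD)
    have x: "x < m"
    proof (rule ccontr)
      assume "\<not> x < m"
      then have "takeWhile Not u = replicate m False @ replicate (x - m) False"
        by (simp add: tw flip: replicate_add)
      then have "u = replicate m False @ (replicate (x - m) False @ dropWhile Not u)"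
          using takeWhile_dropWhile_id[of Not u] by simp
      with False show False by blast
    qed
    show ?thesis
    proof (cases "dropWhile Not u")
      case Nil
      with takeWhile_dropWhile_id[of Not u] tw have "u = replicate x False" by simp
      with x show ?thesis by (intro exI[of _ "[]"] exI[of _ "[x]"]) simp
    next
      case (Cons c u')
      then have "c" using hd_dropWhile[of Not u] by simp
      with Cons takeWhile_dropWhile_id[of Not u] tw have u: "u = replicate x False @ True # u'"
        by simp
      then have "length u' < length u" by simp
      with 1 obtain ss v where "length v = Suc (count_list ss False)" "\<forall>x\<in>set v. x < m" "u' = encode m ss v"
        by blast
      with u x show ?thesis by (intro exI[of _ "False # ss"] exI[of _ "x # v"]) simp
    qed
  qed
qed

lemma replicate_True_cancel:
  "replicate x False @ True # u = replicate y False @ True # w \<longleftrightarrow> x = y \<and> u = w"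
proof (induction x arbitrary: y)
  case 0
  show ?case by (cases y) auto
next
  case (Suc x)
  then show ?case by (cases y) auto
qed

lemma replicate_append_ne_replicate_True:
  assumes "x < m"
  shows "replicate m False @ u \<noteq> replicate x False @ True # w"
proof
  assume "replicate m False @ u = replicate x False @ True # w"
  then have "(replicate m False @ u) ! x = (replicate x False @ True # w) ! x" by simp
  with assms show False by (simp add: nth_append)
qed

lemma replicate_ne_append_True: "replicate n False \<noteq> u @ True # w"
proof
  assume "replicate n False = u @ True # w"
  then have "True \<in> set (replicate n False)" by simp
  then show False by (auto split: if_splits)
qed

text \<open>The bound \<open>x < m\<close> leaves no choice: the word starts with \<open>a^m\<close>
  exactly if the first block has type \<open>True\<close>, and otherwise the exponent is read off at
  the first \<open>True\<close>.\<close>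

lemma encode_inject:
  assumes "length v = Suc (count_list ss False)" "\<forall>x\<in>set v. x < m"
    and "length v' = Suc (count_list ss' False)" "\<forall>x\<in>set v'. x < m"
    and "encode m ss v = encode m ss' v'"
  shows "ss = ss' \<and> v = v'"
  using assms
proof (induction ss arbitrary: v ss' v')
  case Nil
  then obtain x where v: "v = [x]" "x < m" by (auto simp: length_Suc_conv)
  have "ss' = []"
  proof (rule ccontr)
    assume "ss' \<noteq> []"
    then obtain s t where ss': "ss' = s # t" by (cases ss') auto
    show False
    proof (cases s)
      case True
      with Nil ss' v have "length (replicate x False) = length (replicate m False @ encode m t v')" by simp
      with v show False by simp
    next
      case False
      with Nil ss' v show False using replicate_ne_append_True by simp
    qed
  qed
  moreover from this Nil obtain y where "v' = [y]" by (auto simp: length_Suc_conv)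
  ultimately show ?case using Nil v by simp
next
  case (Cons s ss)
  obtain x w where v: "v = x # w" "x < m" using Cons.prems by (cases v) auto
  obtain y w' where v': "v' = y # w'" "y < m" using Cons.prems by (cases v') auto
  show ?case
  proof (cases ss')
    case Nil
    show ?thesis
    proof (cases s)
      case True
      with Nil Cons.prems v' have "length (replicate y False) = length (replicate m False @ encode m ss v)" by simp
      with v' show ?thesis by simp
    next
      case False
      with Nil Cons.prems(5) v v' have "replicate y False = replicate x False @ True # encode m ss w"
        by simp
      then show ?thesis using replicate_ne_append_True by blast
    qed
  next
    case c: (Cons s' t)
    consider "s \<and> s'" | "s \<and> \<not> s'" | "\<not> s \<and> s'" | "\<not> s \<and> \<not> s'" by blast
    then show ?thesis
    proof cases
      case 1
      with Cons.prems c Cons.IH[of v v' t] show ?thesis by simp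
    next
      case 2
      with Cons.prems(5) c v v' have "replicate m False @ encode m ss v = replicate y False @ True # encode m t w'"
        by simp
      then show ?thesis using replicate_append_ne_replicate_True[OF v'(2)] by blast
    next
      case 3
      with Cons.prems(5) c v v' have "replicate m False @ encode m t v' = replicate x False @ True # encode m ss w"
        by simp
      then show ?thesis using replicate_append_ne_replicate_True[OF v(2)] by blast
    next
      case 4
      with Cons.prems c v v' Cons.IH[of w w' t] show ?thesis by (simp add: replicate_True_cancel)
    qed
  qed
qed

subsection \<open>Averaging over rotations\<close>

text \<open>\<open>f\<close> sees the type of a block and the numbers \<open>a\<close>,
  \<open>b\<close> of earlier blocks of type \<open>True\<close> and \<open>False\<close>. The
  remainder counts as one more block of type \<open>False\<close>.\<close>

fun block_sum :: "(bool \<Rightarrow> nat \<Rightarrow> nat \<Rightarrow> int) \<Rightarrow> nat \<Rightarrow> nat \<Rightarrow> bool list \<Rightarrow> int" where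
  "block_sum f a b [] = f False a b"
| "block_sum f a b (s # ss) = f s a b + (if s then block_sum f (Suc a) b ss else block_sum f a (Suc b) ss)"

lemma block_sum_sum: "(\<Sum>r\<in>I. block_sum (f r) a b ss) = block_sum (\<lambda>s a b. \<Sum>r\<in>I. f r s a b) a b ss"
  by (induction ss arbitrary: a b) (auto simp: sum.distrib)

lemma block_sum_altdef:
  "block_sum f a b ss =
     (\<Sum>n<length ss. f (ss ! n) (a + count_list (take n ss) True) (b + count_list (take n ss) False))
     + f False (a + count_list ss True) (b + count_list ss False)"
proof (induction ss arbitrary: a b)
  case (Cons s ss)
  show ?case
    by (cases s) (simp_all add: Cons.IH sum.lessThan_Suc_shift del: sum.lessThan_Suc)
qed auto

text \<open>The prefix sums inside a block form an interval. As a difference of two step functions,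
  its indicator splits into terms that each involve a single partial sum of exponents, which can be
  averaged separately.\<close>

definition heav :: "int \<Rightarrow> int" where
  "heav z = of_bool (0 \<le> z)"

lemma visits_replicate:
  "visits m (replicate n False @ u) z = heav z - heav (z - int n) + visits m u (z - int n)"
proof (induction n arbitrary: z)
  case (Suc n)
  show ?case by (simp add: Suc.IH heav_def algebra_simps)
qed (auto simp: heav_def)

lemma visits_replicate':
  "visits m (replicate n False) z = heav z - heav (z - int n - 1)"
  using visits_replicate[of m n "[]" z] by (auto simp: heav_def)

text \<open>\<open>Q b z\<close> stands for \<open>heav\<close> at \<open>z\<close> minus the first
  \<open>b\<close> exponents, or for a sum of such terms over rotations. \<open>z'\<close> is
  \<open>z\<close> less everything else that precedes the block. A block \<open>a^x b\<close>
  contributes the \<open>x + 1\<close> values from its start on, so its upper end uses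
  \<open>Suc b\<close> exponents.\<close>

definition block_visits :: "nat \<Rightarrow> (nat \<Rightarrow> int \<Rightarrow> int) \<Rightarrow> int \<Rightarrow> bool \<Rightarrow> nat \<Rightarrow> nat \<Rightarrow> int" where
  "block_visits m Q z s a b =
     (let z' = z - int m * int a - (int m + 1) * int b in
      if s then Q b z' - Q b (z' - int m) else Q b z' - Q (Suc b) (z' - 1))"

lemma block_visits_sum:
  "(\<Sum>r\<in>I. block_visits m (Q r) z s a b) = block_visits m (\<lambda>b z. \<Sum>r\<in>I. Q r b z) z s a b"
  by (simp add: block_visits_def Let_def sum_subtractf)

text \<open>For the induction the statement concerns the part of a word behind \<open>a\<close>
  blocks \<open>a^m\<close> and \<open>b\<close> blocks with exponents; the shift of
  \<open>z\<close> is the total length of these blocks.\<close>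

lemma visits_encode_drop:
  assumes "length v = Suc (b + count_list ss False)"
  shows "visits m (encode m ss (drop b v)) 
           (z - int m * int a - (int m + 1) * int b - int (sum_list (take b v))) =
         block_sum (block_visits m (\<lambda>b z. heav (z - int (sum_list (take b v)))) z) a b ss"
  using assms
proof (induction ss arbitrary: a b)
  case Nil
  then have b: "b < length v" by simp
  then have "hd (drop b v) = v ! b" by (simp add: hd_drop_conv_nth)
  then show ?case using b
    by (simp add: visits_replicate' block_visits_def Let_def take_Suc_conv_app_nth algebra_simps)
next
  case (Cons s ss)
  then have b: "b < length v" by simp
  then have hd: "hd (drop b v) = v ! b" by (simp add: hd_drop_conv_nth)
  show ?case
  proof (cases s)
    case True
    with Cons.prems have "length v = Suc (b + count_list ss False)" by simp
    from Cons.IH[OF this, of "Suc a"] True show ?thesis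
      by (simp add: visits_replicate block_visits_def Let_def algebra_simps)
  next
    case False
    with Cons.prems have "length v = Suc (Suc b + count_list ss False)" by simp
    from Cons.IH[OF this, of a] False hd b show ?thesis
      by (simp add: visits_replicate block_visits_def Let_def take_Suc_conv_app_nth drop_Suc tl_drop heav_def algebra_simps)
  qed
qed

lemma visits_encode:
  assumes "length v = Suc (count_list ss False)"
  shows "visits m (encode m ss v) z =
         block_sum (block_visits m (\<lambda>b z. heav (z - int (sum_list (take b v)))) z) 0 0 ss"
  using visits_encode_drop[of v 0 ss m z 0] assms by simp

section \<open>Rotations, reversals and cyclic windows\<close>

lemma sum_rotate_shift:
  fixes h :: "'a list \<Rightarrow> int"
  shows "(\<Sum>p<length xs. h (rotate (p + c) xs)) = (\<Sum>p<length xs. h (rotate p xs))"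
proof (induction c)
  case (Suc c)
  let ?g = "\<lambda>p. h (rotate (p + c) xs)"
  have "(\<Sum>p<length xs. h (rotate (p + Suc c) xs)) = (\<Sum>p<length xs. ?g (Suc p))"
    by simp
  also have "\<dots> = (\<Sum>p<length xs. ?g p) + ?g (length xs) - ?g 0"
    using sum.lessThan_Suc_shift[of ?g "length xs"] sum.lessThan_Suc[of ?g "length xs"] by simp
  also have "?g (length xs) = ?g 0"
    by (metis add_0 mod_add_self1 rotate_conv_mod)
  finally show ?case using Suc by simp
qed simp

text \<open>The first \<open>b\<close> entries of a reversed list are the last \<open>b\<close> of
  the list, and rotation by \<open>length v - b\<close> brings these to the front. Both sides thus
  run over the same cyclic windows.\<close>

lemma sum_take_rev_rotate:
  fixes h :: "nat \<Rightarrow> int"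
  shows "(\<Sum>r<length v. h (sum_list (take b (rev (rotate r v))))) = (\<Sum>r<length v. h (sum_list (take b (rotate r v))))"
proof -
  define c where "c = length v - b"
  have "take b (rotate (r + c) v) = rev (take b (rev (rotate r v)))" for r
  proof -
    let ?x = "rotate r v"
    have "rotate (r + c) v = rotate c ?x" by (simp add: rotate_rotate add.commute)
    also have "\<dots> = drop c ?x @ take c ?x"
    proof (cases "c < length v")
      case True
      then show ?thesis by (simp add: rotate_drop_take)
    next
      case False
      then have "c = length v" by (simp add: c_def)
      then show ?thesis by simp
    qed
    finally show ?thesis by (cases "b \<le> length v") (simp_all add: take_rev c_def)
  qed
  then have "sum_list (take b (rev (rotate r v))) = sum_list (take b (rotate (r + c) v))" for r
    by (simp add: sum_list_rev)
  then show ?thesis using sum_rotate_shift[of "\<lambda>x. h (sum_list (take b x))" c v] by simp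
qed

lemma count_list_rotate [simp]: "count_list (rotate n xs) x = count_list xs x"
proof (induction n)
  case (Suc n)
  have "count_list (rotate1 ys) x = count_list ys x" for ys :: "'a list"
    by (cases ys) auto
  with Suc show ?case by simp
qed simp

lemma count_list_True_False: "count_list ss True + count_list ss False = length ss"
  by (induction ss) auto

text \<open>Both sides telescope over the cyclic windows of lengths \<open>n\<close> and \<open>n + 1\<close>: a window of
  length \<open>n + 1\<close> either ends or begins with the distinguished letter.\<close>

lemma sum_cyclic_windows:
  fixes f :: "bool \<Rightarrow> nat \<Rightarrow> nat \<Rightarrow> int"
  assumes n: "n < length ss"
  defines "X \<equiv> (\<lambda>p. rotate p ss)"
  shows "(\<Sum>p<length ss. f (X p ! n) (count_list (take n (X p)) True) (count_list (take n (X p)) False)) =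
         (\<Sum>p<length ss. f (X p ! 0) (count_list (take n (tl (X p))) True) (count_list (take n (tl (X p))) False))"
    (is "?lhs = ?rhs")
proof -
  \<comment> \<open>\<open>Lam\<close> depends only on the content of a word and is built so that
    adding a letter \<open>s\<close> at either end of a word of length \<open>n\<close> raises it by
    \<open>f s\<close> at the content of that word.\<close>
  define Lam where "Lam = (\<lambda>w. (\<Sum>i<count_list w True. f True i (n - i)) + (\<Sum>i<count_list w False. f False (n - i) i))"
  have cnt: "n - count_list w True = count_list w False" "n - count_list w False = count_list w True"
    if "length w = n" for w
    using count_list_True_False[of w] that by auto
  have end_letter: "f s (count_list w True) (count_list w False) = Lam (w @ [s]) - Lam w"
    and begin_letter: "f s (count_list w True) (count_list w False) = Lam (s # w) - Lam w"
    if "length w = n" for s w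
    using cnt[OF that] by (cases s; simp add: Lam_def)+
  have "f (X p ! n) (count_list (take n (X p)) True) (count_list (take n (X p)) False) =
        Lam (take (Suc n) (X p)) - Lam (take n (X p))" for p
    using n by (subst end_letter) (auto simp: X_def take_Suc_conv_app_nth)
  then have "?lhs = (\<Sum>p<length ss. Lam (take (Suc n) (X p))) - (\<Sum>p<length ss. Lam (take n (X p)))"
    by (simp add: sum_subtractf)
  moreover have "f (X p ! 0) (count_list (take n (tl (X p))) True) (count_list (take n (tl (X p))) False) =
        Lam (take (Suc n) (X p)) - Lam (take n (X (p + 1)))" for p
  proof -
    obtain x xs where X: "X p = x # xs" using n by (cases "X p") (auto simp: X_def)
    moreover from this have "length xs = length ss - 1" by (metis X_def length_rotate length_tl list.sel(3))
    ultimately show ?thesis using n by (subst begin_letter) (auto simp: X_def)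
  qed
  then have "?rhs = (\<Sum>p<length ss. Lam (take (Suc n) (X p))) - (\<Sum>p<length ss. Lam (take n (X (p + 1))))"
    by (simp add: sum_subtractf)
  ultimately show ?thesis using sum_rotate_shift[of "\<lambda>x. Lam (take n x)" 1 ss] by (simp add: X_def)
qed

text \<open>In a reversed rotation the letter at position \<open>n\<close> follows the window that
  came after it before reversal, so \<open>sum_cyclic_windows\<close> applies for each
  \<open>n\<close>. The term of the remainder depends only on letter counts.\<close>

lemma sum_block_sum_rev_rotate:
  "(\<Sum>p<length ss. block_sum f 0 0 (rev (rotate p ss))) = (\<Sum>p<length ss. block_sum f 0 0 (rotate p ss))"
proof -
  let ?c = "\<lambda>n x. f (x ! n) (count_list (take n x) True) (count_list (take n x) False)"
  have "(\<Sum>p<length ss. ?c n (rev (rotate p ss))) = (\<Sum>p<length ss. ?c n (rotate p ss))"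
    if n: "n < length ss" for n
  proof -
    let ?d = "\<lambda>x. f (x ! 0) (count_list (take n (tl x)) True) (count_list (take n (tl x)) False)"
    define c where "c = length ss - Suc n"
    have "?c n (rev (rotate p ss)) = ?d (rotate (p + c) ss)" for p
    proof -
      let ?x = "rotate p ss"
      have "rotate (p + c) ss = rotate c ?x" by (simp add: rotate_rotate add.commute)
      also have "\<dots> = drop c ?x @ take c ?x"
        using n by (simp add: rotate_drop_take c_def)
      also have "drop c ?x = ?x ! c # drop (Suc c) ?x"
        using n by (simp add: Cons_nth_drop_Suc c_def)
      finally show ?thesis using n by (simp add: c_def rev_nth take_rev Suc_diff_Suc)
    qed
    then show ?thesis
      using sum_rotate_shift[of ?d c ss] sum_cyclic_windows[OF n, of f] by simp
  qed
  then show ?thesis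
    by (simp add: block_sum_altdef sum.distrib) (subst (1 2) sum.swap, simp)
qed

text \<open>Summing over \<open>r\<close> first gives a \<open>block_sum\<close> with the same
  \<open>f\<close> on both sides, since sums over cyclic windows of exponents do not notice
  reversal. What is left is the reversal of the block types.\<close>

lemma sum_visits_encode_rotate:
  fixes ss v z
  assumes "length v = Suc (count_list ss False)"
  shows "(\<Sum>p<length ss. \<Sum>r<length v. visits m (encode m (rotate p ss) (rotate r v)) z) =
         (\<Sum>p<length ss. \<Sum>r<length v. visits m (rev (encode m (rotate p ss) (rotate r v))) z)"
proof -
  define f where "f = block_visits m (\<lambda>b z. \<Sum>r<length v. heav (z - int (sum_list (take b (rotate r v))))) z"
  have "(\<Sum>r<length v. visits m (encode m (rotate p ss) (rotate r v)) z) = block_sum f 0 0 (rotate p ss)" for p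
    using assms by (simp add: visits_encode block_sum_sum block_visits_sum f_def)
  moreover have "(\<Sum>r<length v. visits m (rev (encode m (rotate p ss) (rotate r v))) z) = block_sum f 0 0 (rev (rotate p ss))" for p
  proof -
    have "(\<Sum>r<length v. visits m (rev (encode m (rotate p ss) (rotate r v))) z) =
      block_sum (block_visits m (\<lambda>b z. \<Sum>r<length v. heav (z - int (sum_list (take b (rev (rotate r v)))))) z)
        0 0 (rev (rotate p ss))"
      using assms by (simp add: rev_encode visits_encode block_sum_sum block_visits_sum)
    also have "(\<lambda>b z. \<Sum>r<length v. heav (z - int (sum_list (take b (rev (rotate r v)))))) =
      (\<lambda>b z. \<Sum>r<length v. heav (z - int (sum_list (take b (rotate r v)))))"
      by (intro ext sum_take_rev_rotate)
    finally show ?thesis by (simp only: f_def)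
  qed
  ultimately show ?thesis by (simp add: sum_block_sum_rev_rotate)
qed

section \<open>From a simultaneous rotation to independent rotations\<close>

lemma sum_funpow_bij:
  fixes g :: "'a \<Rightarrow> int"
  assumes "finite T" "inj_on nx T" "nx ` T \<subseteq> T"
  shows "(\<Sum>t\<in>T. g ((nx ^^ k) t)) = (\<Sum>t\<in>T. g t)"
proof (induction k)
  case (Suc k)
  have "nx ` T = T" using assms by (simp add: endo_inj_surj)
  then have "(\<Sum>t\<in>T. g ((nx ^^ k) (nx t))) = (\<Sum>t\<in>T. g ((nx ^^ k) t))"
    using sum.reindex[OF assms(2), of "\<lambda>t. g ((nx ^^ k) t)"] by simp
  with Suc show ?case by (simp add: funpow_swap1)
qed simp

text \<open>After \<open>R\<close> applications of \<open>nx\<close> the list \<open>A\<close> is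
  back, while \<open>V\<close> has been rotated by \<open>L - 1\<close>, which is prime to
  \<open>L\<close>. Hence sums over \<open>T\<close> are invariant under rotating \<open>V\<close>
  alone, then also under rotating \<open>A\<close> alone, and a multiple of the sum is a sum of
  double averages.\<close>

lemma sum_block_rotation_eq_0:
  fixes D :: "bool list \<Rightarrow> nat list \<Rightarrow> int"
  assumes T: "finite T" "inj_on nx T" "nx ` T \<subseteq> T"
    and R: "0 < R" "\<And>t. t \<in> T \<Longrightarrow> length (A t) = R"
    and L: "\<And>t. t \<in> T \<Longrightarrow> length (V t) = L" "\<And>t. t \<in> T \<Longrightarrow> L = Suc (count_list (A t) False)"
    and A: "\<And>t. t \<in> T \<Longrightarrow> A (nx t) = rotate1 (A t)"
    and V: "\<And>t. t \<in> T \<Longrightarrow> V (nx t) = (if hd (A t) then V t else rotate1 (V t))"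
    and D: "\<And>ss v. length v = Suc (count_list ss False) \<Longrightarrow>
              (\<Sum>p<length ss. \<Sum>r<length v. D (rotate p ss) (rotate r v)) = 0"
  shows "(\<Sum>t\<in>T. D (A t) (V t)) = 0"
proof -
  have mem: "(nx ^^ n) t \<in> T" if "t \<in> T" for n t
    using that T(3) by (induction n) auto
  have A': "A ((nx ^^ n) t) = rotate n (A t)" if "t \<in> T" for n t
    using that by (induction n) (auto simp: A mem)
  have V': "V ((nx ^^ n) t) = rotate (count_list (take n (A t)) False) (V t)" if "t \<in> T" "n \<le> R" for n t
    using that(2)
  proof (induction n)
    case (Suc n)
    then have n: "n < length (A t)" using R that by simp
    then have "hd (rotate n (A t)) = A t ! n" by (subst hd_rotate_conv_nth) auto
    with Suc n that show ?case by (simp add: V mem A' take_Suc_conv_app_nth)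
  qed simp
  define N where "N = nx ^^ R"
  have N: "N t \<in> T" "A (N t) = A t" "V (N t) = rotate (L - 1) (V t)" if "t \<in> T" for t
    using that mem A'[of t R] V'[of t R] R L(2)[of t] by (simp_all add: N_def)
  have NN: "(N ^^ n) t \<in> T \<and> A ((N ^^ n) t) = A t \<and> V ((N ^^ n) t) = rotate ((L - 1) * n) (V t)" if "t \<in> T" for n t
    using that by (induction n) (auto simp: N rotate_rotate)
  have sumN: "(\<Sum>t\<in>T. g ((N ^^ n) t)) = (\<Sum>t\<in>T. g t)" for n and g :: "_ \<Rightarrow> int"
    using sum_funpow_bij[OF T, of g "R * n"] by (simp add: N_def funpow_mult mult.commute)
  have r1: "(\<Sum>t\<in>T. g (A t) (rotate1 (V t))) = (\<Sum>t\<in>T. g (A t) (V t))" for g :: "_ \<Rightarrow> _ \<Rightarrow> int"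
  proof -
    \<comment> \<open>\<open>N\<close> rotates \<open>V\<close> by \<open>L - 1\<close>, and \<open>(L - 1)\<^sup>2\<close> is 1 modulo \<open>L\<close>\<close>
    have "rotate ((L - 1) * (L - 1)) (V t) = rotate1 (V t)" if "t \<in> T" for t
    proof (cases "L \<le> 1")
      case True
      then show ?thesis using L(1)[OF that] by simp
    next
      case False
      then obtain k where "L = Suc (Suc k)" by (intro that[of "L - 2"]) simp
      then have "(L - 1) * (L - 1) = 1 + k * L" by simp
      then have "((L - 1) * (L - 1)) mod length (V t) = 1 mod length (V t)"
        by (simp only: L(1)[OF that] mod_mult_self1)
      then have "rotate ((L - 1) * (L - 1)) (V t) = rotate 1 (V t)" by (metis rotate_conv_mod)
      then show ?thesis by simp
    qed
    then show ?thesis using sumN[of "\<lambda>t. g (A t) (V t)" "L - 1"] NN by simp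
  qed
  have r: "(\<Sum>t\<in>T. g (A t) (rotate r (V t))) = (\<Sum>t\<in>T. g (A t) (V t))" for g :: "_ \<Rightarrow> _ \<Rightarrow> int" and r
  proof (induction r)
    case (Suc r)
    then show ?case using r1[of "\<lambda>a v. g a (rotate r v)"] by (simp add: rotate1_rotate_swap)
  qed simp
  \<comment> \<open>Summing over all rotations of \<open>v\<close> hides the conditional rotation of
    \<open>V\<close> by \<open>nx\<close>, so that \<open>nx\<close> acts on \<open>A\<close>
    alone.\<close>
  define G where "G = (\<lambda>a v. \<Sum>r<L. D a (rotate r v))"
  have G: "G a (rotate1 v) = G a v" if "length v = L" for a v
    using sum_rotate_shift[of "D a" 1 v] that by (simp add: G_def rotate1_rotate_swap)
  have p1: "(\<Sum>t\<in>T. g (rotate1 (A t)) (V t)) = (\<Sum>t\<in>T. g (A t) (V t))"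
    if "\<And>a v. length v = L \<Longrightarrow> g a (rotate1 v) = g a v" for g :: "_ \<Rightarrow> _ \<Rightarrow> int"
    using that sum_funpow_bij[OF T, of "\<lambda>t. g (A t) (V t)" 1] by (simp add: A V L if_distrib cong: if_cong)
  have p: "(\<Sum>t\<in>T. G (rotate p (A t)) (V t)) = (\<Sum>t\<in>T. G (A t) (V t))" for p
  proof (induction p)
    case (Suc p)
    then show ?case using p1[of "\<lambda>a v. G (rotate p a) v"] G
      by (simp add: rotate1_rotate_swap)
  qed simp
  have "int R * (int L * (\<Sum>t\<in>T. D (A t) (V t))) = (\<Sum>p<R. \<Sum>t\<in>T. G (rotate p (A t)) (V t))"
    using r[of D] by (simp add: p) (simp add: G_def sum.swap[of _ _ T])
  also have "\<dots> = (\<Sum>t\<in>T. \<Sum>p<R. G (rotate p (A t)) (V t))"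
    by (rule sum.swap)
  also have "\<dots> = 0"
  proof (rule sum.neutral, rule ballI)
    fix t assume t: "t \<in> T"
    then have "length (V t) = Suc (count_list (A t) False)" using L by simp
    from D[OF this] show "(\<Sum>p<R. G (rotate p (A t)) (V t)) = 0"
      by (simp only: G_def R(2)[OF t] L(1)[OF t])
  qed
  finally show ?thesis
    using R L by (cases "T = {}") auto
qed

subsection \<open>Snakes on the board of an orbit\<close>

lemma sum_shift_periodic:
  fixes g :: "nat \<Rightarrow> int"
  assumes "g q = g 0"
  shows "(\<Sum>t<q. g (Suc t)) = (\<Sum>t<q. g t)"
  using sum.lessThan_Suc_shift[of g q] sum.lessThan_Suc[of g q] assms by simp

text \<open>\<open>W t x\<close> says that letter \<open>x\<close> of the \<open>t\<close>-th word
  is 1. Columns are integers and cells off the board are \<open>False\<close>, so neighbourhoods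
  need no truncation. \<open>step\<close> describes a sweep from left to right: new letters to the
  left, old letters from \<open>x\<close> on.\<close>

locale orbit_board =
  fixes m N q :: nat and W :: "nat \<Rightarrow> int \<Rightarrow> bool"
  assumes m: "1 \<le> m" "m < N" and q: "0 < q"
    and periodic: "W (t + q) x \<longleftrightarrow> W t x"
    and range: "W t x \<Longrightarrow> 0 \<le> x \<and> x < int N"
    and sparse: "W t x \<Longrightarrow> W t y \<Longrightarrow> x < y \<Longrightarrow> x + int m < y"
    and step: "0 \<le> x \<Longrightarrow> x < int N \<Longrightarrow> W (Suc t) x \<longleftrightarrow>
        (\<forall>y. x - int m \<le> y \<and> y < x \<longrightarrow> \<not> W (Suc t) y) \<and> (\<forall>y. x \<le> y \<and> y \<le> x + int m \<longrightarrow> \<not> W t y)"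
begin

lemma clears: "W t x \<Longrightarrow> x - int m \<le> y \<Longrightarrow> y \<le> x \<Longrightarrow> \<not> W (Suc t) y"
  using step[of y t] range[of "Suc t" y] by auto

lemma sparse': "W t x \<Longrightarrow> x - int m \<le> y \<Longrightarrow> y \<le> x + int m \<Longrightarrow> y \<noteq> x \<Longrightarrow> \<not> W t y"
  using sparse[of t x y] sparse[of t y x] by fastforce

text \<open>The 1 at \<open>(t, x)\<close> excludes every obstruction to a 1 at
  \<open>(t + 1, x + 1)\<close> except one at \<open>(t, x + m + 1)\<close>.\<close>

lemma step_forward:
  assumes "W t x" "x + 1 < int N"
  shows "W (Suc t) (x + 1) \<longleftrightarrow> \<not> W t (x + int m + 1)"
proof
  assume "W (Suc t) (x + 1)"
  with step[of "x + 1" t] range[OF assms(1)] assms(2)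
  show "\<not> W t (x + int m + 1)" by auto
next
  assume n: "\<not> W t (x + int m + 1)"
  have "\<not> W (Suc t) y" if "x + 1 - int m \<le> y \<and> y < x + 1" for y
    using clears[OF assms(1)] that by simp
  moreover have "\<not> W t y" if "x + 1 \<le> y \<and> y \<le> x + 1 + int m" for y
    using n that sparse'[OF assms(1), of y] by (cases "y = x + int m + 1") auto
  ultimately show "W (Suc t) (x + 1)"
    using step[of "x + 1" t] range[OF assms(1)] assms(2) by auto
qed

text \<open>The cell \<open>(t + 1, x - 1)\<close> is 0, so something obstructs it. The 1 at
  \<open>(t + 1, x)\<close> leaves only \<open>(t, x - 1)\<close> and
  \<open>(t + 1, x - m - 1)\<close> as candidates.\<close>

lemma step_backward:
  assumes "W (Suc t) x" "1 \<le> x"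
  shows "W t (x - 1) \<longleftrightarrow> \<not> W (Suc t) (x - int m - 1)"
proof
  assume "W t (x - 1)"
  then show "\<not> W (Suc t) (x - int m - 1)" by (rule clears) auto
next
  assume n: "\<not> W (Suc t) (x - int m - 1)"
  have x: "x < int N" using range[OF assms(1)] by simp
  have "\<not> W (Suc t) (x - 1)" using sparse'[OF assms(1), of "x - 1"] m by auto
  with step[of "x - 1" t] x assms(2)
  obtain y where y: "(x - 1 - int m \<le> y \<and> y < x - 1 \<and> W (Suc t) y) \<or> (x - 1 \<le> y \<and> y \<le> x - 1 + int m \<and> W t y)"
    by auto
  have "\<not> (x - 1 - int m \<le> y \<and> y < x - 1 \<and> W (Suc t) y)"
    using n sparse'[OF assms(1), of y] by (cases "y = x - int m - 1") auto
  moreover have "\<not> (x \<le> y \<and> y \<le> x + int m \<and> W t y)"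
    using step[of x t] assms x by auto
  ultimately have "y = x - 1" "W t y" using y by force+
  then show "W t (x - 1)" by simp
qed

fun snake :: "nat \<Rightarrow> int \<Rightarrow> bool list \<Rightarrow> bool" where
  "snake t x [] \<longleftrightarrow> W t x \<and> x = int N - 1"
| "snake t x (c # u) \<longleftrightarrow> W t x \<and> (if c then snake t (x + int m + 1) u else snake (Suc t) (x + 1) u)"

lemma snake_W: "snake t x u \<Longrightarrow> W t x"
  by (cases u) auto

lemma snake_span: "snake t x u \<Longrightarrow> x + span m u = int N - 1"
  by (induction u arbitrary: t x) (force split: if_splits)+

lemma snake_exists: "W t x \<Longrightarrow> \<exists>u. snake t x u"
proof (induction "nat (int N - x)" arbitrary: t x rule: less_induct)
  case less
  have x: "x < int N" using range[OF less.prems] by simp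
  consider "x = int N - 1" | "W t (x + int m + 1)" | "W (Suc t) (x + 1)"
    using step_forward[OF less.prems] x by fastforce
  then show ?case
  proof cases
    case 1
    with less.prems show ?thesis by (intro exI[of _ "[]"]) simp
  next
    case 2
    with less.hyps[of "x + int m + 1" t] x obtain u where "snake t (x + int m + 1) u" by auto
    with less.prems show ?thesis by (intro exI[of _ "True # u"]) simp
  next
    case 3
    with less.hyps[of "x + 1" "Suc t"] x obtain u where "snake (Suc t) (x + 1) u" by auto
    with less.prems show ?thesis by (intro exI[of _ "False # u"]) simp
  qed
qed

lemma snake_Cons_less: "snake t x (c # u) \<Longrightarrow> x < int N - 1"
  by (cases c) (auto dest!: snake_W range)

lemma snake_unique: "snake t x u \<Longrightarrow> snake t x w \<Longrightarrow> u = w"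
proof (induction u arbitrary: t x w)
  case Nil
  then show ?case by (cases w) (auto dest: snake_Cons_less simp del: snake.simps(2))
next
  case (Cons c u)
  show ?case
  proof (cases w)
    case Nil
    with Cons.prems snake_Cons_less[of t x c u] show ?thesis by (simp del: snake.simps(2))
  next
    case (Cons d w')
    have "c = d"
    proof (rule ccontr)
      assume "c \<noteq> d"
      with Cons.prems \<open>w = d # w'\<close> have "W t x" "W t (x + int m + 1)" "W (Suc t) (x + 1)"
        by (auto split: if_splits dest: snake_W)
      then show False using step_forward[of t x] range[of "Suc t" "x + 1"] by auto
    qed
    with Cons.prems Cons.IH \<open>w = d # w'\<close> show ?thesis by (auto split: if_splits)
  qed
qed

lemma snake_periodic: "snake (t + q) x u \<longleftrightarrow> snake t x u"
proof (induction u arbitrary: t x)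
  case (Cons c u)
  from Cons[of "Suc t"] Cons[of t] show ?case by (simp add: periodic)
qed (simp add: periodic)

lemma mod_periodic: "P (t mod q) \<longleftrightarrow> P t" if "\<And>t. P (t + q) \<longleftrightarrow> P t" for P :: "nat \<Rightarrow> bool"
proof -
  have "P (r + q * k) \<longleftrightarrow> P r" for r k
    by (induction k) (auto simp: that add.assoc[symmetric] add.commute[of q])
  from this[of "t mod q" "t div q"] show ?thesis by simp
qed

section \<open>Counting a column through snakes\<close>

definition word_at :: "nat \<Rightarrow> int \<Rightarrow> bool list" where
  "word_at t x = (THE u. snake t x u)"

lemma word_at_eq: "snake t x u \<Longrightarrow> word_at t x = u"
  unfolding word_at_def using snake_unique by blast

lemma snake_word_at: "W t x \<Longrightarrow> snake t x (word_at t x)"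
  using snake_exists word_at_eq by metis

text \<open>A conserved flow: the weight crossing column \<open>k\<close> is the same for all
  \<open>k\<close> up to \<open>y\<close>. At \<open>k = 0\<close> it is the right-hand side; at
  \<open>k = y\<close> every 1 of the column has weight 1.\<close>

lemma column_sum:
  assumes y: "0 \<le> y" "y < int N"
  shows "(\<Sum>t<q. of_bool (W t y)) = (\<Sum>t<q. if W t 0 then visits m (word_at t 0) y else 0)"
proof -
  \<comment> \<open>\<open>h\<close> is 1 if the snake from the cell visits column \<open>y\<close>,
    else 0; \<open>a\<close> and \<open>b\<close> are this weight carried along a diagonal step and
    a jump. \<open>out\<close> and \<open>inc\<close> below balance outgoing and incoming
    steps.\<close>
  define h where "h = (\<lambda>t x. if W t x then visits m (word_at t x) (y - x) else 0)"
  define H where "H = (\<lambda>x. \<Sum>t<q. h t x)"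
  define a where "a = (\<lambda>t x. of_bool (W t x) * h (Suc t) (x + 1))"
  define b where "b = (\<lambda>t x. of_bool (W t x) * h t (x + int m + 1))"
  define B where "B = (\<lambda>x. \<Sum>t<q. b t x)"
  have out: "h t x = a t x + b t x" if "x < y" for t x
  proof (cases "W t x")
    case True
    show ?thesis
    proof (cases "W t (x + int m + 1)")
      case T: True
      have "word_at t x = True # word_at t (x + int m + 1)"
        using True T by (intro word_at_eq) (simp add: snake_word_at)
      moreover have "\<not> W (Suc t) (x + 1)" using step_forward[OF True] T that y by simp
      ultimately show ?thesis using True T that by (simp add: h_def a_def b_def algebra_simps)
    next
      case F: False
      then have S: "W (Suc t) (x + 1)" using step_forward[OF True] that y by simp
      have "word_at t x = False # word_at (Suc t) (x + 1)"
        using True S by (intro word_at_eq) (simp add: snake_word_at)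
      then show ?thesis using True F S that by (simp add: h_def a_def b_def algebra_simps)
    qed
  qed (simp add: h_def a_def b_def)
  have inc: "h (Suc t) x = a t (x - 1) + b (Suc t) (x - int m - 1)" if "1 \<le> x" for t x
    using step_backward[of t x] that by (cases "W (Suc t) x") (auto simp: a_def b_def h_def)
  have per: "h (t + q) x = h t x" for t x
    by (simp add: h_def periodic word_at_def snake_periodic)
  have H_shift: "(\<Sum>t<q. h (Suc t) x) = H x" "(\<Sum>t<q. b (Suc t) x) = B x" for x
    using sum_shift_periodic[of "\<lambda>t. h t x" q] sum_shift_periodic[of "\<lambda>t. b t x" q] per[of 0] periodic[of 0]
    by (simp_all only: H_def B_def b_def add_0)
  have B_0: "B x = 0" if "x < 0 \<or> y - int m \<le> x" for x
  proof -
    have "b t x = 0" for t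
      using that range[of t x] by (auto simp: b_def h_def visits_neg)
    then show ?thesis by (simp add: B_def)
  qed
  \<comment> \<open>the snakes that meet column \<open>k\<close> or jump over it, counted if they go on to column \<open>y\<close>\<close>
  have "H (int k) + (\<Sum>x\<in>{int k - int m..<int k}. B x) = H 0" if "int k \<le> y" for k
    using that
  proof (induction k)
    case 0
    then show ?case by (simp add: B_0)
  next
    case (Suc k)
    have "H (int k + 1) = (\<Sum>t<q. a t (int k)) + B (int k - int m)"
      using inc[of "int k + 1"] by (simp add: H_shift[symmetric] sum.distrib)
    moreover have "H (int k) = (\<Sum>t<q. a t (int k)) + B (int k)"
      using out[of "int k"] Suc.prems by (simp add: H_def B_def sum.distrib)
    moreover have "{int k - int m..<int k} = insert (int k - int m) {int k + 1 - int m..<int k}"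
      "{int k + 1 - int m..<int k + 1} = insert (int k) {int k + 1 - int m..<int k}"
      using m by auto
    ultimately show ?case using Suc by (simp add: add.commute)
  qed
  from this[of "nat y"] y have "H y = H 0" by (simp add: B_0)
  then show ?thesis by (simp add: H_def h_def visits_0 of_bool_def cong: if_cong)
qed

section \<open>The next snake\<close>

lemma snake_replicate_False:
  assumes "snake t x (replicate n False @ u)"
  shows "snake (t + n) (x + int n) u" and "k \<le> n \<Longrightarrow> W (t + k) (x + int k)"
proof -
  have "snake (t + n) (x + int n) u \<and> (\<forall>k\<le>n. W (t + k) (x + int k))" using assms
  proof (induction n arbitrary: t x)
    case 0
    then show ?case by (simp add: snake_W)
  next
    case (Suc n)
    then have *: "W t x" "snake (Suc t) (x + 1) (replicate n False @ u)" by auto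
    show ?case
    proof (intro conjI allI impI)
      show "snake (t + Suc n) (x + int (Suc n)) u" using Suc.IH[OF *(2)] by (simp add: algebra_simps)
      show "W (t + k) (x + int k)" if "k \<le> Suc n" for k
        using that Suc.IH[OF *(2)] *(1) by (cases k) (auto simp: algebra_simps)
    qed
  qed
  then show "snake (t + n) (x + int n) u" and "k \<le> n \<Longrightarrow> W (t + k) (x + int k)" by auto
qed

text \<open>This close to the right border a jump would leave the board, so
  \<open>step_forward\<close> forces diagonal steps.\<close>

lemma snake_final:
  assumes "W t x" "x + int n = int N - 1" "n \<le> m"
  shows "snake t x (replicate n False)"
  using assms
proof (induction n arbitrary: t x)
  case (Suc n)
  then have "W (Suc t) (x + 1)" using step_forward[of t x] range[of t "x + int m + 1"] by auto
  with Suc show ?case by simp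
qed simp

text \<open>Two rows down and \<open>d\<close> columns to the left, every step is copied. A jump
  clears row \<open>t + 1\<close> from \<open>x - m\<close> to \<open>x + m + 1\<close>, which makes
  room for the copied jump; a diagonal step reaches \<open>(t + 1, x + 1)\<close>, which clears the
  landing cell of a competing jump. The bounds on \<open>d\<close> place the relevant cells in these
  ranges. \<open>fin\<close> supplies the end \<open>w\<close> once the old snake has
  stopped.\<close>

lemma snake_transport:
  assumes "snake t x u" "W (t + 2) (x - d)" "int m \<le> d" "d \<le> 2 * int m"
    and fin: "\<And>t. W t (int N - 1) \<Longrightarrow> W (t + 2) (int N - 1 - d) \<Longrightarrow> snake (t + 2) (int N - 1 - d) w"
  shows "snake (t + 2) (x - d) (u @ w)"
  using assms(1,2)
proof (induction u arbitrary: t x)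
  case Nil
  then show ?case using fin[of t] by auto
next
  case (Cons c u)
  have x: "0 \<le> x - d" "x < int N" using range Cons.prems snake_W by blast+
  have fw: "W (t + 3) (x - d + 1) \<longleftrightarrow> \<not> W (t + 2) (x - d + int m + 1)"
    using step_forward[OF Cons.prems(2)] x assms(3) m by (simp add: numeral_3_eq_3)
  show ?case
  proof (cases c)
    case True
    with Cons.prems have W: "W t x" "W t (x + int m + 1)" "snake t (x + int m + 1) u"
      by (auto dest: snake_W)
    have z: "\<not> W (Suc t) y" if "x - int m \<le> y" "y \<le> x + int m + 1" for y
      using clears[OF W(1), of y] clears[OF W(2), of y] that by (cases "y \<le> x") auto
    have "\<not> W (Suc (Suc t)) y" if "x - d + 1 \<le> y \<and> y < x - d + int m + 1" for y
      using sparse'[OF Cons.prems(2), of y] that by auto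
    moreover have "\<not> W (Suc t) y" if "x - d + int m + 1 \<le> y \<and> y \<le> x - d + int m + 1 + int m" for y
      using z[of y] that assms(3,4) by auto
    ultimately have "W (Suc (Suc t)) (x - d + int m + 1)"
      using step[of "x - d + int m + 1" "Suc t"] x assms(3,4) range[OF W(2)] m by auto
    then have "snake (t + 2) (x + int m + 1 - d) (u @ w)"
      using Cons.IH[OF W(3)] by (simp add: algebra_simps)
    with True Cons.prems(2) show ?thesis by (simp add: algebra_simps)
  next
    case False
    with Cons.prems have W: "W (Suc t) (x + 1)" "snake (Suc t) (x + 1) u"
      by (auto dest: snake_W)
    have "\<not> W (Suc (Suc t)) (x - d + int m + 1)"
      using clears[OF W(1), of "x - d + int m + 1"] assms(3,4) by auto
    with fw have "W (t + 3) (x - d + 1)" by (simp add: numeral_2_eq_2)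
    then have "snake (Suc t + 2) (x + 1 - d) (u @ w)"
      using Cons.IH[OF W(2)] by (simp add: algebra_simps numeral_3_eq_3)
    with False Cons.prems(2) show ?thesis by (simp add: algebra_simps)
  qed
qed

text \<open>The next 1 in column 0 appears two rows below the end of the initial diagonal run. From
  there the new snake copies the old one behind its first block, with \<open>d\<close> the length of
  that block, and the last \<open>d\<close> columns take the reversed block.\<close>

lemma next_snake:
  assumes "snake t 0 (encode m (s # ss) v)" and len: "length v = Suc (count_list (s # ss) False)"
    and "\<forall>x\<in>set v. x < m"
  defines "g \<equiv> (if s then m else hd v) + 2"
  shows "snake (t + g) 0 (encode m (ss @ [s]) (if s then v else rotate1 v))"
    and "0 < k \<Longrightarrow> k < g \<Longrightarrow> \<not> W (t + k) 0"
proof -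
  define n where "n = (if s then m else hd v)"
  have v: "v \<noteq> []" using len by auto
  then have hd_less: "hd v < m" using assms(3) by simp
  have n_le: "n \<le> m" using hd_less by (simp add: n_def)
  define u where "u = (if s then encode m ss v else True # encode m ss (tl v))"
  have "snake t 0 (replicate n False @ u)" using assms(1) by (simp add: n_def u_def split: if_splits)
  note rep = snake_replicate_False[OF this, simplified]
  have g: "g = n + 2" by (simp add: g_def n_def)
  show k: "\<not> W (t + k) 0" if "0 < k" "k < g" for k
  proof -
    have "\<not> W (Suc (t + (k - 1))) 0"
      using rep(2)[of "k - 1"] that g n_le by (intro clears[of _ "int (k - 1)"]) auto
    with that show ?thesis by simp
  qed
  \<comment> \<open>Row \<open>t + n + 1\<close> is free near the left border: up to column
    \<open>n\<close> because of the 1 at \<open>(t + n, n)\<close>, and beyond it, for a block with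
    exponent, because of the landing cell of the jump.\<close>
  have gap: "\<not> W (Suc (t + n)) y" if "0 \<le> y" "y \<le> int m" for y
  proof (cases "y \<le> int n")
    case True
    then show ?thesis using rep(2)[of n] that n_le by (intro clears[of _ "int n"]) auto
  next
    case False
    then have "\<not> s" using that by (auto simp: n_def)
    then have "W (t + n) (int n + int m + 1)" using rep(1) by (auto simp: u_def dest: snake_W)
    then show ?thesis using False that by (intro clears[of _ "int n + int m + 1"]) auto
  qed
  have start: "W (t + n + 2) 0"
  proof -
    have "\<not> W k y" if "y < 0" for k y using range[of k y] that by auto
    then show ?thesis using step[of 0 "Suc (t + n)"] gap m by auto
  qed
  show "snake (t + g) 0 (encode m (ss @ [s]) (if s then v else rotate1 v))"
  proof (cases s)
    case True
    have "snake (t + n + 2) (int n - int m) (encode m ss v @ replicate m False)"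
    proof (rule snake_transport)
      fix t assume "W (t + 2) (int N - 1 - int m)"
      then show "snake (t + 2) (int N - 1 - int m) (replicate m False)" by (rule snake_final) auto
    qed (use rep(1) start True in \<open>auto simp: u_def n_def\<close>)
    with True show ?thesis by (simp add: encode_snoc_True n_def g_def add.assoc)
  next
    case False
    define d where "d = int m + 1 + int n"
    have "snake (t + n + 2) (int n + int m + 1 - d) (encode m ss (tl v) @ True # replicate n False)"
    proof (rule snake_transport)
      show "d \<le> 2 * int m" "int m \<le> d" using False hd_less by (auto simp: d_def n_def)
      show "snake (t + n) (int n + int m + 1) (encode m ss (tl v))"
        using rep(1) False by (simp add: u_def)
      show "W (t + n + 2) (int n + int m + 1 - d)" using start by (simp add: d_def)
      fix t assume W: "W t (int N - 1)" "W (t + 2) (int N - 1 - d)"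
      \<comment> \<open>The landing cell of a jump from column \<open>N - 1 - d\<close>, as
        \<open>d = m + 1 + n\<close>.\<close>
      let ?x = "int N - 1 - int n"
      have "\<not> W (Suc (Suc t)) y" if "?x - int m \<le> y \<and> y < ?x" for y
        using sparse'[OF W(2), of y] that by (auto simp: d_def)
      moreover have "\<not> W (Suc t) y" if "?x \<le> y \<and> y \<le> ?x + int m" for y
        using clears[OF W(1), of y] range[of "Suc t" y] n_le that by force
      moreover have "0 \<le> ?x" using n_le m by simp
      ultimately have "W (t + 2) ?x" using step[of ?x "Suc t"] by auto
      then have "snake (t + 2) ?x (replicate n False)" by (rule snake_final) (use n_le in auto)
      with W(2) show "snake (t + 2) (int N - 1 - d) (True # replicate n False)"
        by (simp add: d_def algebra_simps)
    qed
    moreover have "rotate1 v = tl v @ [n]" using v False by (simp add: rotate1_hd_tl n_def)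
    moreover have "length (tl v) = Suc (count_list ss False)" using len False by simp
    ultimately show ?thesis using False g by (simp add: encode_snoc_False d_def add.assoc)
  qed
qed

section \<open>Symmetry of the column sums on the board\<close>

lemma W_mod: "W (t mod q) x \<longleftrightarrow> W t x"
  using mod_periodic[of "\<lambda>t. W t x"] periodic by simp

lemma snake_mod: "snake (t mod q) x u \<longleftrightarrow> snake t x u"
  using mod_periodic[of "\<lambda>t. snake t x u"] snake_periodic by simp

lemma add_mod_cancel: "(a + c) mod n = (b + c) mod n \<Longrightarrow> a mod n = b mod (n::nat)"
  by (auto simp: nat_mod_eq_iff)

text \<open>If the gaps differed, one start would lie strictly inside the longer gap of the other.
  This gives injectivity of the passage to the next snake.\<close>

lemma gap_unique:
  assumes "W t 0" "W t' 0" "t < q" "t' < q" "(t + g) mod q = (t' + g') mod q" "0 < g" "0 < g'"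
    and "\<And>k. 0 < k \<Longrightarrow> k < g \<Longrightarrow> \<not> W (t + k) 0" "\<And>k. 0 < k \<Longrightarrow> k < g' \<Longrightarrow> \<not> W (t' + k) 0"
  shows "t = t'"
proof -
  have le: "g' \<le> g"
    if "W t 0" "(t + g) mod q = (t' + g') mod q" "0 < g" "\<And>k. 0 < k \<Longrightarrow> k < g' \<Longrightarrow> \<not> W (t' + k) 0" for t t' g g'
  proof (rule ccontr)
    assume "\<not> g' \<le> g"
    then have "(t + g) mod q = (t' + (g' - g) + g) mod q" using that(2) by simp
    then have "t mod q = (t' + (g' - g)) mod q" by (rule add_mod_cancel)
    then have "W (t' + (g' - g)) 0" using that(1) W_mod by metis
    then show False using that(3) that(4)[of "g' - g"] \<open>\<not> g' \<le> g\<close> by simp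
  qed
  have "g = g'"
    using le[of t g t' g'] le[of t' g' t g] assms by (metis le_antisym)
  with assms(5) have "t mod q = t' mod q" by (blast intro: add_mod_cancel)
  then show ?thesis using assms by simp
qed

lemma column_symmetry:
  assumes "0 \<le> y" "y < int N"
  shows "(\<Sum>t<q. of_bool (W t y)) = (\<Sum>t<q. of_bool (W t (int N - 1 - y)) :: int)"
proof -
  define T where "T = {t. t < q \<and> W t 0}"
  have "\<exists>ss v. length v = Suc (count_list ss False) \<and> (\<forall>x\<in>set v. x < m) \<and> word_at t 0 = encode m ss v" for t
    by (rule encode_exhaust) (use m in simp)
  then obtain A V where V: "length (V t) = Suc (count_list (A t) False)" "\<forall>x\<in>set (V t). x < m"
    and enc: "word_at t 0 = encode m (A t) (V t)" for t
    by metis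
  have snake: "snake t 0 (encode m (A t) (V t))" if "t \<in> T" for t
    using that snake_word_at[of t 0] by (simp add: T_def enc)
  define gap where "gap = (\<lambda>t. (if hd (A t) then m else hd (V t)) + 2)"
  define nx where "nx = (\<lambda>t. (t + gap t) mod q)"
  \<comment> \<open>Without blocks the word is \<open>a^l\<close> with \<open>l < m\<close>, too
    short to span \<open>N - 1 \<ge> m\<close> columns.\<close>
  have ne: "A t \<noteq> []" if "t \<in> T" for t
  proof
    assume "A t = []"
    with V[of t] snake_span[OF snake[OF that]] m show False by (auto simp: length_Suc_conv)
  qed
  have A_eq: "A t = hd (A t) # tl (A t)" if "t \<in> T" for t using ne that by simp
  have snake': "snake t 0 (encode m (hd (A t) # tl (A t)) (V t))"
    and V': "length (V t) = Suc (count_list (hd (A t) # tl (A t)) False)" if "t \<in> T" for t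
    using snake V A_eq that by metis+
  have next_T: "snake (nx t) 0 (encode m (rotate1 (A t)) (if hd (A t) then V t else rotate1 (V t)))"
    if "t \<in> T" for t
    using next_snake(1)[OF snake' V' V(2)] that ne
    by (simp add: nx_def snake_mod rotate1_hd_tl gap_def)
  then have nxT: "nx t \<in> T" if "t \<in> T" for t
    using that q by (auto simp: T_def nx_def dest: snake_W)
  have AV: "A (nx t) = rotate1 (A t)" "V (nx t) = (if hd (A t) then V t else rotate1 (V t))" if "t \<in> T" for t
  proof -
    have c: "count_list (rotate1 (A t)) False = count_list (A t) False"
      using count_list_rotate[of 1 "A t" False] by simp
    have "encode m (A (nx t)) (V (nx t)) = encode m (rotate1 (A t)) (if hd (A t) then V t else rotate1 (V t))"
      using word_at_eq[OF next_T[OF that]] enc by simp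
    then have "A (nx t) = rotate1 (A t) \<and> V (nx t) = (if hd (A t) then V t else rotate1 (V t))"
      by (intro encode_inject) (use V c in auto)
    then show "A (nx t) = rotate1 (A t)" "V (nx t) = (if hd (A t) then V t else rotate1 (V t))" by auto
  qed
  have inj: "inj_on nx T"
  proof (rule inj_onI)
    fix t t' assume t: "t \<in> T" "t' \<in> T" and "nx t = nx t'"
    then show "t = t'"
      using next_snake(2)[OF snake' V' V(2), of t] next_snake(2)[OF snake' V' V(2), of t']
      by (intro gap_unique[of t t' "gap t" "gap t'"]) (auto simp: T_def nx_def gap_def)
  qed
  define D where "D = (\<lambda>ss v. visits m (encode m ss v) y - visits m (rev (encode m ss v)) y)"
  \<comment> \<open>\<open>nx\<close> preserves both lengths, so \<open>T\<close> splits into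
    invariant classes on which they are constant, as \<open>sum_block_rotation_eq_0\<close>
    demands.\<close>
  define key where "key = (\<lambda>t. (length (A t), length (V t)))"
  have fin: "finite T" by (simp add: T_def)
  have class_0: "(\<Sum>t | t \<in> T \<and> key t = (R, L). D (A t) (V t)) = 0" if "(R, L) \<in> key ` T" for R L
  proof (rule sum_block_rotation_eq_0[where nx = nx and R = R and L = L])
    show "0 < R" using that ne by (auto simp: key_def)
    show "inj_on nx {t \<in> T. key t = (R, L)}" using inj by (auto simp: inj_on_def)
    show "nx ` {t \<in> T. key t = (R, L)} \<subseteq> {t \<in> T. key t = (R, L)}"
      using nxT AV by (auto simp: key_def)
    show "(\<Sum>p<length ss. \<Sum>r<length v. D (rotate p ss) (rotate r v)) = 0"
      if "length v = Suc (count_list ss False)" for ss v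
      unfolding D_def sum_subtractf using sum_visits_encode_rotate[OF that, of m y] by simp
  qed (use fin AV V in \<open>auto simp: key_def\<close>)
  have "(\<Sum>t\<in>T. D (A t) (V t)) = (\<Sum>c\<in>key ` T. \<Sum>t | t \<in> T \<and> key t = c. D (A t) (V t))"
    by (rule sum.image_gen[OF fin])
  also have "\<dots> = 0"
  proof (rule sum.neutral, rule ballI)
    fix c assume "c \<in> key ` T"
    then show "(\<Sum>t | t \<in> T \<and> key t = c. D (A t) (V t)) = 0"
      using class_0[of "fst c" "snd c"] by simp
  qed
  finally have "(\<Sum>t\<in>T. D (A t) (V t)) = 0" .
  \<comment> \<open>A snake spans \<open>N - 1\<close> columns, so its reversed word visits
    \<open>y\<close> exactly if the word itself visits \<open>N - 1 - y\<close>.\<close>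
  moreover have "D (A t) (V t) = visits m (word_at t 0) y - visits m (word_at t 0) (int N - 1 - y)" if "t \<in> T" for t
  proof -
    have "span m (word_at t 0) = int N - 1" using snake_span[OF snake[OF that]] enc by simp
    then show ?thesis by (simp add: D_def enc[symmetric] visits_rev)
  qed
  ultimately have "(\<Sum>t\<in>T. visits m (word_at t 0) y) = (\<Sum>t\<in>T. visits m (word_at t 0) (int N - 1 - y))"
    by (simp add: sum_subtractf)
  moreover have "(\<Sum>t<q. of_bool (W t x)) = (\<Sum>t\<in>T. visits m (word_at t 0) x)"
    if "0 \<le> x" "x < int N" for x
  proof -
    have "T = {t \<in> {..<q}. W t 0}" by (auto simp: T_def)
    then show ?thesis by (simp only: column_sum[OF that] sum.inter_filter finite_lessThan)
  qed
  ultimately show ?thesis using assms by (simp del: sum_of_bool_eq)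
qed

end

subsection \<open>Toggles and sweeps\<close>

lemma words_length: "w \<in> words m N \<Longrightarrow> length w = N"
  by (simp add: words_def)

lemma words_nth:
  assumes "w \<in> words m N" "i < N"
  shows "w ! i = 0 \<or> w ! i = 1"
proof -
  have "w ! i \<in> set w" "set w \<subseteq> {0, 1}" using assms by (auto simp: words_def)
  then show ?thesis by blast
qed

lemma finite_words: "finite (words m N)"
  by (rule finite_subset[OF _ finite_lists_length_eq[of "{0, 1}" N]]) (auto simp: words_def)

lemma words_iff_sparse:
  assumes "m < N"
  shows "w \<in> words m N \<longleftrightarrow> length w = N \<and> set w \<subseteq> {0, 1} \<and>
           (\<forall>i j. i < j \<and> j < N \<and> w ! i = 1 \<and> w ! j = 1 \<longrightarrow> i + m < j)"
proof (intro iffI conjI allI impI)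
  fix i j assume w: "w \<in> words m N" and ij: "i < j \<and> j < N \<and> w ! i = 1 \<and> w ! j = 1"
  show "i + m < j"
  proof (rule ccontr)
    assume "\<not> i + m < j"
    \<comment> \<open>The minimum keeps the window inside the word when \<open>i\<close> is close to
      the right end.\<close>
    define k where "k = min i (N - 1 - m)"
    have "{i, j} \<subseteq> {k..k + m}" using ij assms \<open>\<not> i + m < j\<close> by (auto simp: k_def)
    then have "(\<Sum>l\<in>{i, j}. w ! l) \<le> (\<Sum>l = k..k + m. w ! l)" by (intro sum_mono2) auto
    moreover have "(\<Sum>l\<in>{i, j}. w ! l) = 2" using ij by simp
    moreover have "k + m < N" using assms by (simp add: k_def)
    then have "(\<Sum>l = k..k + m. w ! l) \<le> 1" using w by (simp add: words_def)
    ultimately show False by simp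
  qed
next
  assume w: "length w = N \<and> set w \<subseteq> {0, 1} \<and>
           (\<forall>i j. i < j \<and> j < N \<and> w ! i = 1 \<and> w ! j = 1 \<longrightarrow> i + m < j)"
  have "(\<Sum>l = k..k + m. w ! l) \<le> 1" if k: "k + m < N" for k
  proof (cases "\<exists>j\<in>{k..k + m}. w ! j \<noteq> 0")
    case True
    then obtain j where j: "j \<in> {k..k + m}" "w ! j \<noteq> 0" by blast
    have letter: "w ! l = 0 \<or> w ! l = 1" if "l \<in> {k..k + m}" for l
    proof -
      have "w ! l \<in> set w" using w k that by auto
      with w show ?thesis by blast
    qed
    have "w ! l = 0" if "l \<in> {k..k + m} - {j}" for l
    proof (rule ccontr)
      assume "w ! l \<noteq> 0"
      with letter[of l] letter[OF j(1)] j(2) that have "w ! l = 1" "w ! j = 1" by auto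
      moreover have "l < j \<or> j < l" using that by auto
      ultimately show False using w j(1) that k by fastforce
    qed
    then have "(\<Sum>l\<in>{k..k + m} - {j}. w ! l) = 0" by simp
    then show ?thesis using j letter[of j] by (simp add: sum.remove[of _ j])
  qed simp
  with w show "w \<in> words m N" by (simp add: words_def)
qed (auto simp: words_def)

lemma toggle_in_words: "w \<in> words m N \<Longrightarrow> toggle m N i w \<in> words m N"
  by (simp add: toggle_def Let_def)

lemma toggle_nth_other: "j \<noteq> i \<Longrightarrow> toggle m N i w ! j = w ! j"
  by (simp add: toggle_def Let_def)

lemma toggle_toggle:
  assumes "w \<in> words m N" "i < N"
  shows "toggle m N i (toggle m N i w) = w"
proof -
  have "1 - (1 - w ! i) = w ! i" using words_nth[OF assms] by auto
  then show ?thesis using assms words_length[OF assms(1)] by (simp add: toggle_def Let_def)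
qed

text \<open>Removing a 1 never violates sparsity; inserting one requires that there be no other 1
  within distance \<open>m\<close>.\<close>

lemma toggle_nth:
  assumes "m < N" "w \<in> words m N" "i < N"
  shows "toggle m N i w ! i = 1 \<longleftrightarrow> w ! i \<noteq> 1 \<and> (\<forall>j<N. j \<noteq> i \<and> i \<le> j + m \<and> j \<le> i + m \<longrightarrow> w ! j \<noteq> 1)"
proof (cases "w ! i = 1")
  case True
  then have "w[i := 1 - w ! i] \<in> words m N"
    using assms set_update_subset_insert[of w i 0] by (auto simp: words_iff_sparse nth_list_update)
  with True show ?thesis using words_length[OF assms(2)] assms by (simp add: toggle_def Let_def)
next
  case False
  with words_nth[OF assms(2,3)] have 0: "w ! i = 0" by simp
  have "w[i := 1] \<in> words m N \<longleftrightarrow> (\<forall>j<N. j \<noteq> i \<and> i \<le> j + m \<and> j \<le> i + m \<longrightarrow> w ! j \<noteq> 1)"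
  proof
    assume "w[i := 1] \<in> words m N"
    then have sp: "\<And>k l. k < l \<Longrightarrow> l < N \<Longrightarrow> w[i := 1] ! k = 1 \<Longrightarrow> w[i := 1] ! l = 1 \<Longrightarrow> k + m < l"
      using assms(1) by (simp add: words_iff_sparse)
    show "\<forall>j<N. j \<noteq> i \<and> i \<le> j + m \<and> j \<le> i + m \<longrightarrow> w ! j \<noteq> 1"
    proof (intro allI impI notI)
      fix j assume j: "j < N" "j \<noteq> i \<and> i \<le> j + m \<and> j \<le> i + m" "w ! j = 1"
      then show False using sp[of i j] sp[of j i] assms words_length[OF assms(2)] by (cases "i < j") auto
    qed
  next
    assume "\<forall>j<N. j \<noteq> i \<and> i \<le> j + m \<and> j \<le> i + m \<longrightarrow> w ! j \<noteq> 1"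
    then have far: "\<And>j. j < N \<Longrightarrow> j \<noteq> i \<Longrightarrow> w ! j = 1 \<Longrightarrow> j + m < i \<or> i + m < j" by (meson not_le)
    have "k + m < l" if "k < l" "l < N" "w[i := 1] ! k = 1" "w[i := 1] ! l = 1" for k l
    proof -
      consider "k = i" | "l = i" | "k \<noteq> i" "l \<noteq> i" by blast
      then show ?thesis
      proof cases
        case 1 with far[of l] that show ?thesis by auto
      next
        case 2 with far[of k] that assms show ?thesis by auto
      next
        case 3 with that assms show ?thesis by (simp add: words_iff_sparse)
      qed
    qed
    then show "w[i := 1] \<in> words m N"
      using assms set_update_subset_insert[of w i 1] by (auto simp: words_iff_sparse)
  qed
  with 0 show ?thesis using words_length[OF assms(2)] assms(3) by (simp add: toggle_def Let_def)
qed

section \<open>Sweeps letter by letter\<close>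

definition partial_sweep :: "nat \<Rightarrow> nat \<Rightarrow> nat list \<Rightarrow> nat \<Rightarrow> nat list" where
  "partial_sweep m N w k = fold (toggle m N) [0..<k] w"

lemma partial_sweep_simps [simp]:
  "partial_sweep m N w 0 = w"
  "partial_sweep m N w (Suc k) = toggle m N k (partial_sweep m N w k)"
  by (simp_all add: partial_sweep_def)

lemma sweep_eq: "sweep m N w = partial_sweep m N w N"
  by (simp add: sweep_def partial_sweep_def)

lemma partial_sweep_in_words: "w \<in> words m N \<Longrightarrow> partial_sweep m N w k \<in> words m N"
  by (induction k) (auto simp: toggle_in_words)

lemma partial_sweep_nth_ge: "k \<le> j \<Longrightarrow> partial_sweep m N w k ! j = w ! j"
  by (induction k) (auto simp: toggle_nth_other)

lemma partial_sweep_nth_less: "j < k \<Longrightarrow> k \<le> l \<Longrightarrow> partial_sweep m N w l ! j = partial_sweep m N w k ! j"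
proof (induction l)
  case (Suc l)
  then show ?case by (cases "k = Suc l") (auto simp: toggle_nth_other)
qed simp

lemma sweep_in_words: "w \<in> words m N \<Longrightarrow> sweep m N w \<in> words m N"
  by (simp add: sweep_eq partial_sweep_in_words)

text \<open>When position \<open>i\<close> is toggled, the letters to its left are already new and
  those to its right still old. The case \<open>j = i\<close> of the second condition accounts for
  the removal of an old 1.\<close>

lemma sweep_nth:
  assumes "m < N" "w \<in> words m N" "i < N"
  shows "sweep m N w ! i = 1 \<longleftrightarrow>
    (\<forall>j<i. i \<le> j + m \<longrightarrow> sweep m N w ! j \<noteq> 1) \<and> (\<forall>j<N. i \<le> j \<and> j \<le> i + m \<longrightarrow> w ! j \<noteq> 1)"
proof -
  let ?u = "partial_sweep m N w i"
  have before: "?u ! j = sweep m N w ! j" if "j < i" for j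
    using partial_sweep_nth_less[of j i N] that assms(3) by (simp add: sweep_eq)
  have after: "?u ! j = w ! j" if "i \<le> j" for j
    using partial_sweep_nth_ge that by blast
  have "sweep m N w ! i = toggle m N i ?u ! i"
    using partial_sweep_nth_less[of i "Suc i" N] assms(3) by (simp add: sweep_eq)
  then have "sweep m N w ! i = 1 \<longleftrightarrow>
      w ! i \<noteq> 1 \<and> (\<forall>j<N. j \<noteq> i \<and> i \<le> j + m \<and> j \<le> i + m \<longrightarrow> ?u ! j \<noteq> 1)"
    using toggle_nth[OF assms(1) partial_sweep_in_words[OF assms(2)] assms(3)] after by simp
  also have "\<dots> \<longleftrightarrow> (\<forall>j<i. i \<le> j + m \<longrightarrow> sweep m N w ! j \<noteq> 1) \<and> (\<forall>j<N. i \<le> j \<and> j \<le> i + m \<longrightarrow> w ! j \<noteq> 1)"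
    (is "?l \<longleftrightarrow> ?r")
  proof
    assume l: ?l
    show ?r
    proof (intro conjI allI impI)
      show "sweep m N w ! j \<noteq> 1" if "j < i" "i \<le> j + m" for j
        using l that before[of j] assms(3) by auto
      show "w ! j \<noteq> 1" if "j < N" "i \<le> j \<and> j \<le> i + m" for j
        using l that after[of j] by (cases "j = i") auto
    qed
  next
    assume r: ?r
    have "?u ! j \<noteq> 1" if "j < N" "j \<noteq> i \<and> i \<le> j + m \<and> j \<le> i + m" for j
      using r that before[of j] after[of j] by (cases "j < i") auto
    with r assms(3) show ?l by auto
  qed
  finally show ?thesis .
qed

section \<open>Invertibility and periods\<close>

lemma partial_sweep_inj: "k \<le> N \<Longrightarrow> inj_on (\<lambda>w. partial_sweep m N w k) (words m N)"
proof (induction k)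
  case (Suc k)
  show ?case
  proof (rule inj_onI)
    fix v w assume vw: "v \<in> words m N" "w \<in> words m N"
      and eq: "partial_sweep m N v (Suc k) = partial_sweep m N w (Suc k)"
    have undo: "toggle m N k (partial_sweep m N u (Suc k)) = partial_sweep m N u k" if "u \<in> words m N" for u
      using toggle_toggle[OF partial_sweep_in_words[OF that]] Suc.prems by simp
    have "partial_sweep m N v k = partial_sweep m N w k"
      using undo[OF vw(1)] undo[OF vw(2)] unfolding eq by simp
    with Suc vw show "v = w" by (meson Suc_leD inj_onD)
  qed
qed (simp add: inj_on_def)

lemma finite_inj_recurrent:
  assumes "finite A" "inj_on f A" "f ` A \<subseteq> A" "x \<in> A"
  shows "\<exists>q>0. (f ^^ q) x = x"
proof -
  have f: "bij_betw f A A" using assms by (simp add: bij_betw_def endo_inj_surj)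
  have mem: "(f ^^ n) x \<in> A" for n using assms by (induction n) auto
  have "\<not> inj (\<lambda>n. (f ^^ n) x)"
    using finite_subset[OF _ assms(1), of "range (\<lambda>n. (f ^^ n) x)"] mem finite_imageD[of "\<lambda>n. (f ^^ n) x" UNIV] by auto
  then obtain i j where "i < j" "(f ^^ i) x = (f ^^ j) x"
    unfolding inj_def by (metis linorder_neqE_nat)
  then have "(f ^^ i) x = (f ^^ i) ((f ^^ (j - i)) x)"
    by (metis funpow_add comp_apply le_add_diff_inverse less_imp_le)
  moreover have "inj_on (f ^^ i) A" using bij_betw_funpow[OF f] by (simp add: bij_betw_def)
  ultimately have "(f ^^ (j - i)) x = x" using mem assms(4) by (metis inj_onD)
  with \<open>i < j\<close> show ?thesis by (intro exI[of _ "j - i"]) simp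
qed

lemma period_sweep:
  assumes "w \<in> words m N"
  shows "0 < period (sweep m N) w" "(sweep m N ^^ period (sweep m N) w) w = w"
proof -
  have "inj_on (sweep m N) (words m N)" using partial_sweep_inj[of N N m] by (simp add: sweep_eq[abs_def])
  then have "\<exists>q>0. (sweep m N ^^ q) w = w"
    using finite_inj_recurrent[OF finite_words] assms sweep_in_words by blast
  from LeastI_ex[OF this] show "0 < period (sweep m N) w" "(sweep m N ^^ period (sweep m N) w) w = w"
    by (simp_all add: period_def)
qed

text \<open>For \<open>m = N\<close> there are no windows, so every toggle flips its letter.\<close>

lemma sweep_unconstrained:
  assumes "w \<in> words N N" "i < N"
  shows "sweep N N w ! i = 1 - w ! i"
proof -
  have "toggle N N i u ! i = 1 - u ! i" if "u \<in> words N N" for u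
  proof -
    have "u[i := 1 - u ! i] \<in> words N N"
      using that words_nth[OF that assms(2)] set_update_subset_insert[of u i "1 - u ! i"] by (auto simp: words_def)
    then show ?thesis using words_length[OF that] assms(2) by (simp add: toggle_def)
  qed
  from this[OF partial_sweep_in_words[OF assms(1), of i]] show ?thesis
    using partial_sweep_nth_less[of i "Suc i" N N N w] partial_sweep_nth_ge[of i i N N w] assms(2) by (simp add: sweep_eq)
qed

theorem theorem3:
  fixes m N i :: nat and S :: "nat list"
  assumes "1 \<le> m" and "m \<le> N"
    and "S \<in> words m N" and "i < N"
  shows "(\<Sum>t<period (sweep m N) S. (sweep m N ^^ t) S ! i) =
         (\<Sum>t<period (sweep m N) S. (sweep m N ^^ t) S ! (N - 1 - i))"
proof (cases "m < N")
  case False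
  then have [simp]: "m = N" using assms(2) by simp
  let ?f = "sweep N N"
  have S: "S \<in> words N N" using assms(3) by simp
  have f: "?f S ! j = 1 - S ! j" if "j < N" for j using sweep_unconstrained[OF S that] .
  have "?f (?f S) ! j = S ! j" if "j < N" for j
    using sweep_unconstrained[OF sweep_in_words[OF S] that] f[OF that] words_nth[OF S that] by auto
  then have ff: "?f (?f S) = S"
    using words_length[OF S] words_length[OF sweep_in_words[OF sweep_in_words[OF S]]]
    by (intro nth_equalityI) auto
  have ne: "?f S \<noteq> S" using f[OF assms(4)] words_nth[OF S assms(4)] by auto
  \<comment> \<open>A sweep complements \<open>S\<close>, hence moves it, and two sweeps restore it.
    Each column sum is then 1.\<close>
  have "period ?f S = 2"
    unfolding period_def
  proof (rule Least_equality)
    show "0 < (2 :: nat) \<and> (?f ^^ 2) S = S" using ff by (simp add: numeral_2_eq_2)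
    show "2 \<le> n" if "0 < n \<and> (?f ^^ n) S = S" for n
      using that ne by (cases "n = 1") auto
  qed
  moreover have "S ! j + ?f S ! j = 1" if "j < N" for j using f[OF that] words_nth[OF S that] by auto
  ultimately show ?thesis using assms(4) by (simp add: numeral_2_eq_2)
next
  case m_less: True
  define q where "q = period (sweep m N) S"
  define w where "w = (\<lambda>t. (sweep m N ^^ t) S)"
  define W where "W = (\<lambda>t x. 0 \<le> x \<and> x < int N \<and> w t ! nat x = 1)"
  have w: "w t \<in> words m N" for t
    unfolding w_def by (induction t) (auto simp: assms sweep_in_words)
  have w_Suc: "w (Suc t) = sweep m N (w t)" for t by (simp add: w_def)
  interpret orbit_board m N q W
  proof
    show "W (t + q) x = W t x" for t x
      using period_sweep(2)[OF assms(3)] by (simp add: W_def w_def q_def funpow_add)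
    show "x + int m < y" if "W t x" "W t y" "x < y" for t x y
    proof -
      have "nat x + m < nat y" using that w[of t] m_less by (auto simp: W_def words_iff_sparse)
      then show ?thesis using that by (auto simp: W_def)
    qed
    \<comment> \<open>This is \<open>sweep_nth\<close> carried over to integer columns; cells off
      the board are never 1 and so impose no condition.\<close>
    show "W (Suc t) x \<longleftrightarrow> (\<forall>y. x - int m \<le> y \<and> y < x \<longrightarrow> \<not> W (Suc t) y) \<and>
        (\<forall>y. x \<le> y \<and> y \<le> x + int m \<longrightarrow> \<not> W t y)" (is "_ \<longleftrightarrow> ?l \<and> ?r") if x: "0 \<le> x" "x < int N" for x t
    proof -
      have "?l \<longleftrightarrow> (\<forall>j<nat x. nat x \<le> j + m \<longrightarrow> w (Suc t) ! j \<noteq> 1)"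
      proof (intro iffI allI impI)
        show "w (Suc t) ! j \<noteq> 1" if ?l "j < nat x" "nat x \<le> j + m" for j
        proof -
          have "x - int m \<le> int j \<and> int j < x" using that(2,3) by linarith
          then show ?thesis using that(1) x by (auto simp: W_def)
        qed
        show "\<not> W (Suc t) y" if "\<forall>j<nat x. nat x \<le> j + m \<longrightarrow> w (Suc t) ! j \<noteq> 1" "x - int m \<le> y \<and> y < x" for y
          using that(1)[rule_format, of "nat y"] that(2) by (auto simp: W_def nat_le_iff)
      qed
      moreover have "?r \<longleftrightarrow> (\<forall>j<N. nat x \<le> j \<and> j \<le> nat x + m \<longrightarrow> w t ! j \<noteq> 1)"
      proof (intro iffI allI impI)
        show "w t ! j \<noteq> 1" if ?r "j < N" "nat x \<le> j \<and> j \<le> nat x + m" for j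
        proof -
          have "x \<le> int j \<and> int j \<le> x + int m" using that(3) x by linarith
          then show ?thesis using that(1,2) by (auto simp: W_def)
        qed
        show "\<not> W t y" if "\<forall>j<N. nat x \<le> j \<and> j \<le> nat x + m \<longrightarrow> w t ! j \<noteq> 1" "x \<le> y \<and> y \<le> x + int m" for y
          using that(1)[rule_format, of "nat y"] that(2) x by (auto simp: W_def nat_le_iff nat_less_iff)
      qed
      moreover have "W (Suc t) x \<longleftrightarrow> w (Suc t) ! nat x = 1" using x by (simp add: W_def)
      ultimately show ?thesis
        using sweep_nth[OF m_less w[of t], of "nat x"] x by (simp add: w_Suc)
    qed
  qed (use assms m_less period_sweep(1)[OF assms(3)] in \<open>auto simp: W_def q_def\<close>)
  have "int (\<Sum>t<q. w t ! j) = (\<Sum>t<q. of_bool (W t (int j)))" if "j < N" for j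
  proof -
    have "int (w t ! j) = of_bool (W t (int j))" for t
      using words_nth[OF w[of t] that] that by (auto simp: W_def)
    then show ?thesis by (simp del: sum_of_bool_eq)
  qed
  note column = this
  have mirror: "int (N - 1 - i) = int N - 1 - int i" using assms(4) by auto
  have "int (\<Sum>t<q. w t ! (N - 1 - i)) = (\<Sum>t<q. of_bool (W t (int N - 1 - int i)))"
    using column[of "N - 1 - i"] assms(4) unfolding mirror by simp
  with column[OF assms(4)] column_symmetry[of "int i"] assms(4)
  have "int (\<Sum>t<q. w t ! i) = int (\<Sum>t<q. w t ! (N - 1 - i))"
    by (simp only: of_nat_0_le_iff of_nat_less_iff)
  then show ?thesis by (simp only: of_nat_eq_iff w_def q_def)
qed

end
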